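(* Let $G=\{g_1:=0,g_2,\ldots,g_n\}$ be a finite elementary Abelian group, $G\cong(\mathbb{Z}/p\mathbb{Z})^\nu$ for a prime $p$ and $\nu\ge1$ (so $n=p^\nu$), and let $$L_G=\Big\{{\boldsymbol x}=(x_1,\ldots,x_n)\in\mathbb{Z}^n:\ \sum_{i=1}^n x_i=0,\ \sum_{j=2}^n x_j g_j=0\Big\}.$$ Then $L_G$ is strongly eutactic.
   Context: For a lattice $\Lambda$ let $|\Lambda|$ be its minimal nonzero Euclidean norm and $S(\Lambda)$ its set of vectors of norm $|\Lambda|$. $\Lambda$ is strongly eutactic (in $V=\operatorname{span}_{\mathbb R}\Lambda$) if $\frac{1}{|\Lambda|}S(\Lambda)$ is a spherical $2$-design in $V$, i.e. the average over the unit sphere of $V$ of every real polynomial of degree $\le 2$ equals its average over this finite set; equivalently, $\sum_{{\boldsymbol x}\in S(\Lambda)}({\boldsymbol x},{\boldsymbol y})^2=\frac{|\Lambda|^2|S(\Lambda)|}{\dim V}({\boldsymbol y},{\boldsymbol y})$ for all ${\boldsymbol y}\in V$. *)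

theory Defs
  imports
    "HOL-Analysis.Analysis"
    "HOL-Algebra.FiniteProduct"
    "HOL-Algebra.Elementary_Groups"
    "HOL-Algebra.Product_Groups"
    "HOL-Computational_Algebra.Primes"
begin

text \<open>
  A lattice is a discrete additive subgroup of a Euclidean space, not necessarily of full rank.
\<close>

definition euclidean_lattice :: "'a::euclidean_space set \<Rightarrow> bool" where
  "euclidean_lattice \<Lambda> \<longleftrightarrow>
     0 \<in> \<Lambda> \<and> (\<forall>x\<in>\<Lambda>. \<forall>y\<in>\<Lambda>. x - y \<in> \<Lambda>) \<and> discrete \<Lambda>"

definition min_norm :: "'a::euclidean_space set \<Rightarrow> real" where
  "min_norm \<Lambda> = Inf {norm x | x. x \<in> \<Lambda> \<and> x \<noteq> 0}"

definition min_vectors :: "'a::euclidean_space set \<Rightarrow> 'a set" where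
  "min_vectors \<Lambda> = {x \<in> \<Lambda>. norm x = min_norm \<Lambda>}"

text \<open>
  The polynomial functions of degree at most \<open>t\<close>: real linear combinations of the monomials
  whose exponents \<open>k b\<close> in the coordinates \<open>x \<bullet> b\<close> add up to at most \<open>t\<close>.  Restricted
  to a linear subspace \<open>V\<close>, these are exactly the polynomial functions of degree at most
  \<open>t\<close> on \<open>V\<close>, since the coordinates on \<open>V\<close> are restrictions of linear forms.
\<close>

definition polynomial_degree_le :: "nat \<Rightarrow> ('a::euclidean_space \<Rightarrow> real) \<Rightarrow> bool" where
  "polynomial_degree_le t f \<longleftrightarrow>
     (\<exists>c :: ('a \<Rightarrow> nat) \<Rightarrow> real. \<forall>x.
        f x = (\<Sum>k \<in> {k \<in> Basis \<rightarrow>\<^sub>E {..t}. (\<Sum>b\<in>Basis. k b) \<le> t}.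
                 c k * (\<Prod>b\<in>Basis. (x \<bullet> b) ^ k b)))"

text \<open>
  The normalised surface measure on the unit sphere of a linear subspace \<open>V\<close>: the Borel
  probability measure on that sphere invariant under the orthogonal group of \<open>V\<close>, which is
  unique (and exists as soon as \<open>V \<noteq> {0}\<close>).  Every orthogonal map of \<open>V\<close> is the
  restriction of an orthogonal map of the ambient space that preserves \<open>V\<close>.
\<close>

definition uniform_sphere_measure :: "'a::euclidean_space set \<Rightarrow> 'a measure \<Rightarrow> bool" where
  "uniform_sphere_measure V M \<longleftrightarrow>
     space M = sphere 0 1 \<inter> V \<and>
     sets M = sets (restrict_space borel (sphere 0 1 \<inter> V)) \<and>
     emeasure M (space M) = 1 \<and>
     (\<forall>f. orthogonal_transformation f \<and> f ` V = V \<longrightarrow> distr M M f = M)"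

definition spherical_design :: "nat \<Rightarrow> 'a::euclidean_space set \<Rightarrow> 'a set \<Rightarrow> bool" where
  "spherical_design t V X \<longleftrightarrow>
     finite X \<and> X \<noteq> {} \<and> X \<subseteq> sphere 0 1 \<inter> V \<and>
     (\<exists>M. uniform_sphere_measure V M \<and>
        (\<forall>f. polynomial_degree_le t f \<longrightarrow>
           (\<integral>x. f x \<partial>M) = (\<Sum>x\<in>X. f x) / real (card X)))"

definition strongly_eutactic :: "'a::euclidean_space set \<Rightarrow> bool" where
  "strongly_eutactic \<Lambda> \<longleftrightarrow>
     euclidean_lattice \<Lambda> \<and>
     spherical_design 2 (span \<Lambda>) ((\<lambda>x. (1 / min_norm \<Lambda>) *\<^sub>R x) ` min_vectors \<Lambda>)"

text \<open>
  The coordinates of \<open>\<real>\<^sup>n\<close> are indexed by a finite type \<open>'n\<close> that enumerates the group by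
  \<open>g\<close>; the index \<open>i\<^sub>0\<close> plays the role of \<open>1\<close>, so \<open>g i\<^sub>0\<close> is the neutral element.  The abelian
  group \<open>G\<close> is written multiplicatively, following HOL-Algebra.
\<close>

definition group_lattice :: "('g, 'm) monoid_scheme \<Rightarrow> ('n \<Rightarrow> 'g) \<Rightarrow> 'n \<Rightarrow> (real ^ 'n::finite) set" where
  "group_lattice G g i\<^sub>0 =
     {(\<chi> i. of_int (x i)) | x :: 'n \<Rightarrow> int.
        (\<Sum>i\<in>UNIV. x i) = 0 \<and>
        finprod G (\<lambda>j. g j [^]\<^bsub>G\<^esub> x j) (UNIV - {i\<^sub>0}) = \<one>\<^bsub>G\<^esub>}"

end

theory Submission
  imports
    Defs
    "HOL-Number_Theory.Cong"
    "HOL-Probability.Probability_Mass_Function"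
begin

text \<open>
  An affine map of \<open>G\<close> permutes the coordinates and preserves \<open>L\<^sub>G\<close>, because the coordinates of a
  lattice vector sum to zero.  The affine group of \<open>(\<int>/p\<int>)\<^sup>\<nu>\<close> is doubly transitive, so the mean
  of \<open>x\<^sub>i x\<^sub>j\<close> over the normalised minimal vectors takes one value for \<open>i = j\<close> and another for
  \<open>i \<noteq> j\<close>; these values are forced by \<open>\<Sum>\<^sub>i x\<^sub>i = 0\<close> and \<open>\<Sum>\<^sub>i x\<^sub>i\<^sup>2 = 1\<close>.  The uniform measure on the
  sphere of the span is invariant under the same permutations, hence has the same moments.
\<close>

section \<open>The uniform measure on the unit sphere of a subspace\<close>

text \<open>The definition of a design asks for an actual invariant measure on the sphere of the
  span, so one has to be constructed; afterwards the argument works with its invariance, total mass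
  and support. The minimal vectors are likewise never determined: they enter as a finite nonempty
  set of equal norm that the permutations carry to itself. Degree 2 is what double transitivity
  controls, since a quadratic monomial involves at most two coordinates.

  Double transitivity comes down to automorphisms of \<open>G\<close> acting transitively on the
  non-identity elements, which forces all of these to have the same order. Here \<open>G\<close> is
  a vector space over the field with p elements, and a single rank-one change of the identity map
  moves one nonzero vector to another, provided that some linear form is nonzero at both.\<close>

lemma nn_integral_lborel_reflect:
  fixes h :: "'a::euclidean_space \<Rightarrow> ennreal"
  assumes [measurable]: "h \<in> borel_measurable borel"
  shows "(\<integral>\<^sup>+x. h (c - x) \<partial>lborel) = (\<integral>\<^sup>+x. h x \<partial>lborel)"
proof -
  have "(\<integral>\<^sup>+x. h x \<partial>lborel) = (\<integral>\<^sup>+x. h x \<partial>distr lborel borel (\<lambda>x. c + (-1) *\<^sub>R x))"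
    by (subst lborel_affine[of "-1" c]) (simp_all add: density_1)
  then show ?thesis
    by (simp add: nn_integral_distr)
qed

lemma nn_integral_lborel_translate:
  fixes h :: "'a::euclidean_space \<Rightarrow> ennreal"
  assumes [measurable]: "h \<in> borel_measurable borel"
  shows "(\<integral>\<^sup>+x. h (x - c) \<partial>lborel) = (\<integral>\<^sup>+x. h x \<partial>lborel)"
proof -
  have "(\<integral>\<^sup>+x. h x \<partial>lborel) = (\<integral>\<^sup>+x. h x \<partial>distr lborel borel (\<lambda>x. (-c) + 1 *\<^sub>R x))"
    by (subst lborel_affine[of "1" "-c"]) (simp_all add: density_1)
  then show ?thesis
    by (simp add: nn_integral_distr)
qed

lemma emeasure_lborel_open_nonzero:
  fixes A :: "'a::euclidean_space set"
  assumes "open A" and "A \<noteq> {}"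
  shows "emeasure lborel A \<noteq> 0"
proof
  assume "emeasure lborel A = 0"
  then have "A \<in> null_sets lborel"
    using assms by auto
  then show False
    using open_not_negligible[OF assms]
    by (auto simp: negligible_iff_null_sets null_sets_completionI)
qed

lemma borel_measurable_orthogonal_transformation:
  fixes f :: "'a::euclidean_space \<Rightarrow> 'a"
  assumes "orthogonal_transformation f"
  shows "f \<in> borel_measurable borel"
  using assms by (intro borel_measurable_continuous_onI linear_continuous_on)
     (simp add: orthogonal_transformation_linear linear_conv_bounded_linear[symmetric])

text \<open>
  Haar's uniqueness argument: the double integral of \<open>indicator A x * indicator B (f y - x)\<close>
  equals \<open>|A| |f -` B|\<close> in one order of integration and \<open>|B| |f -` A|\<close> in the other.
  A ball, which \<open>f\<close> preserves, is then taken for \<open>A\<close>.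
\<close>

lemma lborel_distr_orthogonal_transformation:
  fixes f :: "'a::euclidean_space \<Rightarrow> 'a"
  assumes f: "orthogonal_transformation f"
  shows "distr lborel borel f = lborel"
proof (rule measure_eqI)
  note [measurable] = borel_measurable_orthogonal_transformation[OF f]
  have f_diff: "f (x - y) = f x - f y" for x y
    using orthogonal_transformation_linear[OF f] by (rule linear_diff)
  fix B assume "B \<in> sets (distr lborel borel f)"
  then have B[measurable]: "B \<in> sets borel" by simp
  define A :: "'a set" where "A = ball 0 1"
  have A[measurable]: "A \<in> sets borel" by (simp add: A_def)
  have fA: "f -` A = A"
    using f by (auto simp: A_def orthogonal_transformation_norm)
  have fin: "emeasure lborel A < \<infinity>" and nz: "emeasure lborel A \<noteq> 0"
    unfolding A_def
    using emeasure_lborel_ball_finite emeasure_lborel_open_nonzero[of "ball (0::'a) 1"] by auto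
  let ?I = "\<lambda>S x. indicator S x :: ennreal"
  have pre: "(\<integral>\<^sup>+y. ?I S (f y) \<partial>lborel) = emeasure lborel (f -` S)" if [measurable]: "S \<in> sets borel" for S
  proof -
    have "(\<integral>\<^sup>+y. ?I S (f y) \<partial>lborel) = (\<integral>\<^sup>+y. ?I (f -` S) y \<partial>lborel)"
      by (intro nn_integral_cong) (auto simp: indicator_def)
    moreover have "f -` S \<in> sets lborel"
      using measurable_sets[OF borel_measurable_orthogonal_transformation[OF f] that] by simp
    ultimately show ?thesis by simp
  qed
  have shift: "(\<integral>\<^sup>+y. ?I S (f y - x) \<partial>lborel) = emeasure lborel (f -` S)" if [measurable]: "S \<in> sets borel" for S x
  proof -
    \<comment> \<open>A linear isometry is onto, so translating by \<open>x\<close> after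
      \<open>f\<close> is translating by a preimage \<open>w\<close> before \<open>f\<close>, where
      Lebesgue measure is known to be invariant.\<close>
    obtain w where w: "x = f w"
      using orthogonal_transformation_surj[OF f] by blast
    have "(\<integral>\<^sup>+y. ?I S (f y - x) \<partial>lborel) = (\<integral>\<^sup>+y. ?I S (f (y - w)) \<partial>lborel)"
      by (simp add: w f_diff)
    also have "\<dots> = (\<integral>\<^sup>+y. ?I S (f y) \<partial>lborel)"
      by (rule nn_integral_lborel_translate[where h = "\<lambda>y. ?I S (f y)"]) measurable
    finally show ?thesis by (simp add: pre)
  qed
  have "emeasure lborel A * emeasure lborel (f -` B) = (\<integral>\<^sup>+x. ?I A x * emeasure lborel (f -` B) \<partial>lborel)"
    by (simp add: nn_integral_multc)
  also have "\<dots> = (\<integral>\<^sup>+x. (\<integral>\<^sup>+y. ?I A x * ?I B (f y - x) \<partial>lborel) \<partial>lborel)"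
    by (simp add: nn_integral_cmult shift)
  also have "\<dots> = (\<integral>\<^sup>+y. (\<integral>\<^sup>+x. ?I A x * ?I B (f y - x) \<partial>lborel) \<partial>lborel)"
    by (rule lborel_pair.Fubini'[symmetric]) measurable
  \<comment> \<open>The substitution \<open>z = f y - x\<close> moves \<open>f y\<close> into the
    indicator of \<open>A\<close>, so that after another exchange \<open>shift\<close> evaluates the
    integral over \<open>y\<close>.\<close>
  also have "\<dots> = (\<integral>\<^sup>+y. (\<integral>\<^sup>+z. ?I A (f y - z) * ?I B z \<partial>lborel) \<partial>lborel)"
  proof (rule nn_integral_cong)
    fix y
    show "(\<integral>\<^sup>+x. ?I A x * ?I B (f y - x) \<partial>lborel) = (\<integral>\<^sup>+z. ?I A (f y - z) * ?I B z \<partial>lborel)"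
      using nn_integral_lborel_reflect[of "\<lambda>x. ?I A x * ?I B (f y - x)" "f y"] by simp
  qed
  also have "\<dots> = (\<integral>\<^sup>+z. (\<integral>\<^sup>+y. ?I A (f y - z) * ?I B z \<partial>lborel) \<partial>lborel)"
    by (rule lborel_pair.Fubini') measurable
  also have "\<dots> = (\<integral>\<^sup>+z. emeasure lborel A * ?I B z \<partial>lborel)"
    by (simp add: nn_integral_multc shift fA)
  also have "\<dots> = emeasure lborel A * emeasure lborel B"
    by (simp add: nn_integral_cmult)
  finally have "emeasure lborel (f -` B) = emeasure lborel B"
    using fin nz by (subst (asm) ennreal_mult_cancel_left) auto
  then show "emeasure (distr lborel borel f) B = emeasure lborel B"
    by (simp add: emeasure_distr)
qed simp

text \<open>The closest point is characterised by distances and \<open>V\<close> alone, and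
  \<open>f\<close> preserves both.\<close>

lemma closest_point_orthogonal_transformation:
  fixes f :: "'a::euclidean_space \<Rightarrow> 'a"
  assumes f: "orthogonal_transformation f" and V: "f ` V = V" "convex V" "closed V" "V \<noteq> {}"
  shows "closest_point V (f x) = f (closest_point V x)"
proof (rule closest_point_unique[symmetric])
  show "f (closest_point V x) \<in> V"
    using V closest_point_in_set by blast
  show "\<forall>z\<in>V. dist (f x) (f (closest_point V x)) \<le> dist (f x) z"
  proof
    fix z assume "z \<in> V"
    then obtain w where "w \<in> V" "z = f w" using V(1) by blast
    then show "dist (f x) (f (closest_point V x)) \<le> dist (f x) z"
      using f closest_point_le[of V w x] V by (simp add: orthogonal_transformation_isometry)
  qed
qed (use V in auto)

text \<open>
  The measure is obtained from Lebesgue measure on the unit ball of the ambient space, projected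
  orthogonally to \<open>V\<close> and then radially to the sphere.
\<close>

lemma uniform_sphere_measure_exists:
  fixes V :: "'a::euclidean_space set"
  assumes V: "subspace V" and nonzero: "V \<noteq> {0}"
  shows "\<exists>M. uniform_sphere_measure V M"
proof -
  have V': "convex V" "closed V" "V \<noteq> {}"
    using V subspace_0[OF V] by (auto simp: subspace_imp_convex closed_subspace)
  define P where "P = closest_point V"
  \<comment> \<open>Radial projection breaks down where \<open>P x = 0\<close>. Removing this closed
    set leaves an open set, which has positive measure as soon as it is nonempty.\<close>
  define A where "A = ball 0 1 \<inter> {x. P x \<noteq> 0}"
  define N where "N = uniform_measure lborel A"
  define S where "S = sphere 0 1 \<inter> V"
  obtain v0 where v0: "v0 \<in> V" "v0 \<noteq> 0"
    using V nonzero by (metis subspace_0 insert_absorb singletonI subsetI subset_singletonD V'(3) insertI1 subset_antisym)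
  \<comment> \<open>Norm 1/2 puts this vector of \<open>V\<close> inside the unit ball, so it
    witnesses that \<open>A\<close> is nonempty.\<close>
  define v where "v = (1 / (2 * norm v0)) *\<^sub>R v0"
  have v: "v \<in> V" "v \<noteq> 0" "norm v < 1"
    using v0 V by (auto simp: v_def subspace_scale)
  define s where "s = (1 / norm v) *\<^sub>R v"
  have s: "s \<in> S"
    using v V by (simp add: S_def s_def subspace_scale)
  \<comment> \<open>The default value \<open>s\<close> makes \<open>r\<close> total with values in
    \<open>S\<close>. Since \<open>f\<close> may move \<open>s\<close>, commutation of
    \<open>r\<close> with \<open>f\<close> is shown only on \<open>A\<close>, which carries all the
    mass of \<open>N\<close>.\<close>
  define r where "r x = (if P x = 0 then s else (1 / norm (P x)) *\<^sub>R P x)" for x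
  have contP: "continuous_on UNIV P"
    unfolding P_def using V' by (intro continuous_on_closest_point)
  have [measurable]: "P \<in> borel_measurable borel"
    by (rule borel_measurable_continuous_onI[OF contP])
  have r_meas[measurable]: "r \<in> borel_measurable borel"
    unfolding r_def[abs_def] by measurable
  have rS: "r x \<in> S" for x
    using s V closest_point_in_set[of V x] V' by (auto simp: r_def S_def P_def subspace_scale)
  have openA: "open A"
    unfolding A_def using contP by (intro open_Int open_ball open_Collect_neq continuous_on_const)
  then have [measurable]: "A \<in> sets borel" by simp
  have "v \<in> A"
    using v closest_point_self[of v V] by (simp add: A_def P_def)
  have Anz: "emeasure lborel A \<noteq> 0"
    using emeasure_lborel_open_nonzero[OF openA] \<open>v \<in> A\<close> by blast
  have Afin: "emeasure lborel A < \<infinity>"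
    using emeasure_mono[of A "ball 0 1" lborel] emeasure_lborel_ball_finite[of "0::'a" 1]
    by (auto simp: A_def intro: le_less_trans)
  interpret N: prob_space N
    unfolding N_def using Anz Afin by (intro prob_space_uniform_measure) auto
  define M where "M = distr N (restrict_space borel S) r"
  have rM[measurable]: "r \<in> measurable N (restrict_space borel S)"
    using rS by (intro measurable_restrict_space2) (auto simp: N_def)
  have "S \<in> sets borel"
    unfolding S_def using V' by auto
  have "distr M M f = M" if f: "orthogonal_transformation f" and fV: "f ` V = V" for f
  proof -
    note [measurable] = borel_measurable_orthogonal_transformation[OF f]
    have norm_f: "norm (f x) = norm x" for x
      using f by (simp add: orthogonal_transformation_norm)
    have Pf: "P (f x) = f (P x)" for x
      unfolding P_def by (intro closest_point_orthogonal_transformation f fV V')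
    have f0: "f x = 0 \<longleftrightarrow> x = 0" for x
      using norm_f[of x] by (metis norm_eq_zero)
    have fA: "f x \<in> A \<longleftrightarrow> x \<in> A" for x
      by (simp add: A_def Pf f0 norm_f)
    have fS: "f x \<in> S" if "x \<in> S" for x
      using that fV by (auto simp: S_def norm_f)
    have rf: "f (r x) = r (f x)" if "x \<in> A" for x
      using that f by (simp add: A_def r_def Pf f0 norm_f orthogonal_transformation_scaleR)
    have f_meas_S[measurable]: "f \<in> measurable (restrict_space borel S) (restrict_space borel S)"
      using fS by (intro measurable_restrict_space3) auto
    have N_inv: "distr N N f = N"
    proof (rule measure_eqI)
      fix B assume "B \<in> sets (distr N N f)"
      then have [measurable]: "B \<in> sets borel" by (simp add: N_def)
      have "emeasure lborel (f -` (A \<inter> B)) = emeasure (distr lborel borel f) (A \<inter> B)"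
        by (simp add: emeasure_distr)
      also have "\<dots> = emeasure lborel (A \<inter> B)"
        by (simp add: lborel_distr_orthogonal_transformation[OF f])
      also have "f -` (A \<inter> B) = A \<inter> f -` B"
        using fA by auto
      finally have eq: "emeasure lborel (A \<inter> f -` B) = emeasure lborel (A \<inter> B)" .
      have "f -` B \<in> sets lborel"
        using measurable_sets[OF borel_measurable_orthogonal_transformation[OF f] \<open>B \<in> sets borel\<close>] by simp
      then have "emeasure N (f -` B) = emeasure N B"
        unfolding N_def by (simp add: eq)
      then show "emeasure (distr N N f) B = emeasure N B"
        by (subst emeasure_distr) (auto simp: N_def)
    qed (simp add: N_def)
    have "distr M M f = distr M (restrict_space borel S) f"
      by (rule distr_cong) (auto simp: M_def)
    also have "\<dots> = distr N (restrict_space borel S) (f \<circ> r)"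
      unfolding M_def by (intro distr_distr) measurable
    also have "\<dots> = distr N (restrict_space borel S) (r \<circ> f)"
    proof (rule distr_cong_AE)
      show "AE x in N. (f \<circ> r) x = (r \<circ> f) x"
        unfolding N_def using rf by (intro AE_uniform_measureI) auto
    next
      have [measurable]: "f \<in> measurable N N"
        by (simp add: N_def)
      show "f \<circ> r \<in> measurable N (restrict_space borel S)"
        "r \<circ> f \<in> measurable N (restrict_space borel S)"
        by (auto intro: measurable_comp)
    qed auto
    also have "\<dots> = distr (distr N N f) (restrict_space borel S) r"
      by (intro distr_distr[symmetric] rM) (auto simp: N_def)
    also have "\<dots> = M"
      by (simp add: N_inv M_def)
    finally show ?thesis .
  qed
  moreover have "emeasure M (space M) = 1"
    using prob_space.emeasure_space_1[OF N.prob_space_distr[OF rM]] by (simp add: M_def)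
  ultimately have "uniform_sphere_measure V M"
    unfolding uniform_sphere_measure_def by (auto simp: M_def S_def space_restrict_space)
  then show ?thesis ..
qed

section \<open>Integration against the uniform sphere measure\<close>

lemma uniform_sphere_measure_prob_space:
  "uniform_sphere_measure V M \<Longrightarrow> prob_space M"
  unfolding uniform_sphere_measure_def by (elim conjE) (rule prob_spaceI)

text \<open>A continuous function is bounded on the compact unit sphere, and the measure is
  finite.\<close>

lemma uniform_sphere_measure_integrable:
  fixes h :: "'a::euclidean_space \<Rightarrow> real"
  assumes M: "uniform_sphere_measure V M" and h: "continuous_on UNIV h"
  shows "integrable M h"
proof -
  interpret prob_space M
    using M by (rule uniform_sphere_measure_prob_space)
  have "compact (h ` sphere 0 1)"
    using h by (intro compact_continuous_image continuous_on_subset[OF h]) auto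
  then have "bounded (h ` sphere 0 1)"
    by (rule compact_imp_bounded)
  then obtain B where B: "\<And>x. x \<in> sphere 0 1 \<Longrightarrow> norm (h x) \<le> B"
    unfolding bounded_iff by blast
  show ?thesis
  proof (rule integrable_const_bound)
    show "AE x in M. norm (h x) \<le> B"
      using M B by (intro AE_I2) (auto simp: uniform_sphere_measure_def)
    have "h \<in> borel_measurable (restrict_space borel (sphere 0 1 \<inter> V))"
      using h by (intro measurable_restrict_space1 borel_measurable_continuous_onI)
    then show "h \<in> borel_measurable M"
      using M by (simp add: uniform_sphere_measure_def cong: measurable_cong_sets)
  qed
qed

lemma uniform_sphere_measure_integral_invariant:
  fixes h :: "'a::euclidean_space \<Rightarrow> real"
  assumes M: "uniform_sphere_measure V M" and h: "continuous_on UNIV h"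
    and f: "orthogonal_transformation f" "f ` V = V"
  shows "(\<integral>x. h (f x) \<partial>M) = (\<integral>x. h x \<partial>M)"
proof -
  have "f \<in> measurable (restrict_space borel (sphere 0 1 \<inter> V)) (restrict_space borel (sphere 0 1 \<inter> V))"
    using f borel_measurable_orthogonal_transformation[OF f(1)]
    by (intro measurable_restrict_space3) (auto simp: orthogonal_transformation_norm)
  then have "f \<in> measurable M M"
    using M by (simp add: uniform_sphere_measure_def cong: measurable_cong_sets)
  then have "(\<integral>x. h x \<partial>distr M M f) = (\<integral>x. h (f x) \<partial>M)"
    using uniform_sphere_measure_integrable[OF M h] by (intro integral_distr) auto
  then show ?thesis
    using M f by (simp add: uniform_sphere_measure_def)
qed

section \<open>Moments under doubly transitive coordinate permutations\<close>

text \<open>Coordinate \<open>i\<close> after this map is coordinate \<open>\<pi> i\<close> before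
  it, which is the form needed to pull back monomials. To move the unit vector of index
  \<open>i\<close> to that of index \<open>\<sigma> i\<close>, one takes the inverse of
  \<open>\<sigma>\<close> for \<open>\<pi>\<close>.\<close>

definition permute_coords :: "('n \<Rightarrow> 'n) \<Rightarrow> 'a ^ 'n \<Rightarrow> 'a ^ 'n" where
  "permute_coords \<pi> x = (\<chi> i. x $ \<pi> i)"

lemma permute_coords_nth [simp]: "permute_coords \<pi> x $ i = x $ \<pi> i"
  by (simp add: permute_coords_def)

lemma orthogonal_transformation_permute_coords:
  assumes "bij \<pi>"
  shows "orthogonal_transformation (permute_coords \<pi> :: real ^ 'n::finite \<Rightarrow> real ^ 'n)"
proof -
  have "(\<Sum>i\<in>UNIV. v $ \<pi> i * w $ \<pi> i) = (\<Sum>i\<in>UNIV. v $ i * w $ i)" for v w :: "real ^ 'n"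
    using assms by (rule sum.reindex_bij_betw)
  then show ?thesis
    unfolding orthogonal_transformation_def
    by (auto simp: inner_vec_def vec_eq_iff intro!: linearI)
qed

text \<open>Stated for an abstract measure so that it serves both the sphere and the finite set of
  normalised minimal vectors. If D is the common mean of the squares, E that of the mixed products
  and n the number of coordinates, then the norm gives n D = 1, and multiplying the zero sum by one
  coordinate gives D + (n - 1) E = 0.\<close>

lemma doubly_transitive_moments:
  fixes M :: "(real ^ 'n::finite) measure"
  assumes M: "prob_space M"
    and int: "\<And>h :: real ^ 'n \<Rightarrow> real. continuous_on UNIV h \<Longrightarrow> integrable M h"
    and norm: "AE x in M. norm x = 1"
    and sum: "AE x in M. (\<Sum>i\<in>UNIV. x $ i) = 0"
    and trans: "\<And>i j k l. i \<noteq> j \<Longrightarrow> k \<noteq> l \<Longrightarrow> \<exists>\<pi>. \<pi> i = k \<and> \<pi> j = l \<and>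
      (\<forall>h :: real ^ 'n \<Rightarrow> real. continuous_on UNIV h \<longrightarrow> (\<integral>x. h (permute_coords \<pi> x) \<partial>M) = (\<integral>x. h x \<partial>M))"
    and card: "CARD('n) \<ge> 2"
  shows doubly_transitive_first_moment: "(\<integral>x. x $ i \<partial>M) = 0"
    and doubly_transitive_second_moment:
      "(\<integral>x. x $ i * x $ j \<partial>M) =
        (if i = j then 1 / real CARD('n) else - 1 / (real CARD('n) * (real CARD('n) - 1)))"
proof -
  interpret prob_space M by fact
  have int1: "integrable M (\<lambda>x. x $ i)" and int2: "integrable M (\<lambda>x. x $ i * x $ j)" for i j
    by (auto intro!: int continuous_intros)
  \<comment> \<open>The invariance hypothesis speaks of pairs of distinct indices; a single index is
    completed to such a pair.\<close>
  have other: "\<exists>j. j \<noteq> i" for i :: 'n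
  proof (rule ccontr)
    assume "\<nexists>j. j \<noteq> i"
    then have "(UNIV :: 'n set) = {i}" by auto
    then have "CARD('n) = card {i}" by (rule arg_cong)
    then show False using card by simp
  qed
  have first: "(\<integral>x. x $ i \<partial>M) = (\<integral>x. x $ k \<partial>M)" for i k
  proof -
    obtain j l where "j \<noteq> i" "l \<noteq> k" using other by metis
    then obtain \<pi> where "\<pi> i = k" and
      inv: "\<And>h :: real ^ 'n \<Rightarrow> real. continuous_on UNIV h \<Longrightarrow> (\<integral>x. h (permute_coords \<pi> x) \<partial>M) = (\<integral>x. h x \<partial>M)"
      using trans[of i j k l] by blast
    then show ?thesis
      using inv[of "\<lambda>x. x $ i"] by (simp add: continuous_intros)
  qed
  have diag: "(\<integral>x. x $ i * x $ i \<partial>M) = (\<integral>x. x $ k * x $ k \<partial>M)" for i k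
  proof -
    obtain j l where "j \<noteq> i" "l \<noteq> k" using other by metis
    then obtain \<pi> where "\<pi> i = k" and
      inv: "\<And>h :: real ^ 'n \<Rightarrow> real. continuous_on UNIV h \<Longrightarrow> (\<integral>x. h (permute_coords \<pi> x) \<partial>M) = (\<integral>x. h x \<partial>M)"
      using trans[of i j k l] by blast
    then show ?thesis
      using inv[of "\<lambda>x. x $ i * x $ i"] by (simp add: continuous_intros)
  qed
  have off: "(\<integral>x. x $ i * x $ j \<partial>M) = (\<integral>x. x $ k * x $ l \<partial>M)" if "i \<noteq> j" "k \<noteq> l" for i j k l
  proof -
    obtain \<pi> where "\<pi> i = k" "\<pi> j = l" and
      inv: "\<And>h :: real ^ 'n \<Rightarrow> real. continuous_on UNIV h \<Longrightarrow> (\<integral>x. h (permute_coords \<pi> x) \<partial>M) = (\<integral>x. h x \<partial>M)"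
      using trans[OF \<open>i \<noteq> j\<close> \<open>k \<noteq> l\<close>] by blast
    then show ?thesis
      using inv[of "\<lambda>x. x $ i * x $ j"] by (simp add: continuous_intros)
  qed
  have "real CARD('n) * (\<integral>x. x $ i \<partial>M) = (\<Sum>k\<in>(UNIV :: 'n set). \<integral>x. x $ i \<partial>M)"
    by simp
  also have "\<dots> = (\<Sum>k\<in>UNIV. \<integral>x. x $ k \<partial>M)"
    by (intro sum.cong first refl)
  also have "\<dots> = (\<integral>x. (\<Sum>k\<in>UNIV. x $ k) \<partial>M)"
    using int1 by simp
  also have "\<dots> = (\<integral>x. 0 \<partial>M)"
    using sum int1 by (intro integral_cong_AE) auto
  finally show "(\<integral>x. x $ i \<partial>M) = 0"
    by simp
  have "real CARD('n) * (\<integral>x. x $ i * x $ i \<partial>M) = (\<Sum>k\<in>(UNIV :: 'n set). \<integral>x. x $ i * x $ i \<partial>M)" for i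
    by simp
  also have "(\<Sum>k\<in>(UNIV :: 'n set). \<integral>x. x $ i * x $ i \<partial>M) = (\<Sum>k\<in>UNIV. \<integral>x. x $ k * x $ k \<partial>M)" for i
    by (intro sum.cong diag refl)
  also have "(\<Sum>k\<in>UNIV. \<integral>x. x $ k * x $ k \<partial>M) = (\<integral>x. (\<Sum>k\<in>UNIV. x $ k * x $ k) \<partial>M)"
    using int2 by simp
  also have "\<dots> = (\<integral>x. 1 \<partial>M)"
  proof (intro integral_cong_AE)
    have "(\<Sum>k\<in>UNIV. x $ k * x $ k) = (norm x)\<^sup>2" for x :: "real ^ 'n"
      by (simp add: power2_norm_eq_inner inner_vec_def)
    then show "AE x in M. (\<Sum>k\<in>UNIV. x $ k * x $ k) = 1"
      using norm by auto
  qed (use int2 in auto)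
  also have "\<dots> = 1"
    by (simp add: prob_space)
  finally have diag_val: "(\<integral>x. x $ i * x $ i \<partial>M) = 1 / real CARD('n)" for i
    by (simp add: field_simps)
  show "(\<integral>x. x $ i * x $ j \<partial>M) =
      (if i = j then 1 / real CARD('n) else - 1 / (real CARD('n) * (real CARD('n) - 1)))"
  proof (cases "i = j")
    case True
    then show ?thesis using diag_val by simp
  next
    case False
    \<comment> \<open>This vanishing integral expands into one diagonal moment and n - 1 equal mixed
      moments.\<close>
    have "(\<integral>x. x $ i * (\<Sum>k\<in>UNIV. x $ k) \<partial>M) = (\<integral>x. 0 \<partial>M)"
    proof (rule integral_cong_AE)
      show "(\<lambda>x. x $ i * (\<Sum>k\<in>UNIV. x $ k)) \<in> borel_measurable M"
        using int2 by (auto simp: sum_distrib_left)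
      show "AE x in M. x $ i * (\<Sum>k\<in>UNIV. x $ k) = 0"
        using sum by auto
    qed simp
    then have "0 = (\<integral>x. x $ i * (\<Sum>k\<in>UNIV. x $ k) \<partial>M)"
      by simp
    also have "\<dots> = (\<Sum>k\<in>UNIV. \<integral>x. x $ i * x $ k \<partial>M)"
      using int2 by (simp add: sum_distrib_left)
    also have "\<dots> = (\<integral>x. x $ i * x $ i \<partial>M) + (\<Sum>k\<in>UNIV - {i}. \<integral>x. x $ i * x $ k \<partial>M)"
      by (rule sum.remove) auto
    also have "(\<Sum>k\<in>UNIV - {i}. \<integral>x. x $ i * x $ k \<partial>M) = (\<Sum>k\<in>UNIV - {i}. \<integral>x. x $ i * x $ j \<partial>M)"
      using False by (intro sum.cong off) auto
    also have "\<dots> = (real CARD('n) - 1) * (\<integral>x. x $ i * x $ j \<partial>M)"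
      using card by (simp add: card_Diff_singleton of_nat_diff)
    finally have "(real CARD('n) - 1) * (\<integral>x. x $ i * x $ j \<partial>M) = - (1 / real CARD('n))"
      by (simp add: diag_val)
    moreover have "real CARD('n) - 1 > 0"
      using card by simp
    ultimately show ?thesis
      using False by (simp add: field_simps)
  qed
qed

section \<open>Polynomials of degree at most two are determined by first and second moments\<close>

lemma monomial_split:
  fixes k :: "'a::euclidean_space \<Rightarrow> nat"
  assumes "(\<Sum>b\<in>Basis. k b) = Suc m"
  shows "\<exists>b\<in>Basis. \<exists>k'. (\<Sum>b\<in>Basis. k' b) = m \<and>
    (\<forall>x. (\<Prod>b\<in>Basis. (x \<bullet> b) ^ k b) = (x \<bullet> b) * (\<Prod>b\<in>Basis. (x \<bullet> b) ^ k' b))"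
proof -
  \<comment> \<open>A positive total degree forces a positive exponent; lowering it by one splits
    off a linear factor.\<close>
  obtain b where b: "b \<in> Basis" "k b \<noteq> 0"
    using assms by (metis Suc_neq_Zero sum.neutral)
  define k' where "k' = k(b := k b - 1)"
  have "(\<Sum>b\<in>Basis. k b) = k b + (\<Sum>c\<in>Basis - {b}. k c)"
    using b by (intro sum.remove) auto
  moreover have "(\<Sum>b\<in>Basis. k' b) = k' b + (\<Sum>c\<in>Basis - {b}. k' c)"
    using b by (intro sum.remove) auto
  moreover have "(\<Sum>c\<in>Basis - {b}. k' c) = (\<Sum>c\<in>Basis - {b}. k c)"
    by (intro sum.cong) (auto simp: k'_def)
  ultimately have "(\<Sum>b\<in>Basis. k' b) = m"
    using assms b by (simp add: k'_def)
  moreover have "(\<Prod>b\<in>Basis. (x \<bullet> b) ^ k b) = (x \<bullet> b) * (\<Prod>b\<in>Basis. (x \<bullet> b) ^ k' b)" for x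
  proof -
    have "(\<Prod>b\<in>Basis. (x \<bullet> b) ^ k b) = (x \<bullet> b) ^ k b * (\<Prod>c\<in>Basis - {b}. (x \<bullet> c) ^ k c)"
      using b by (intro prod.remove) auto
    also have "(\<Prod>c\<in>Basis - {b}. (x \<bullet> c) ^ k c) = (\<Prod>c\<in>Basis - {b}. (x \<bullet> c) ^ k' c)"
      by (intro prod.cong) (auto simp: k'_def)
    also have "(x \<bullet> b) ^ k b = (x \<bullet> b) * (x \<bullet> b) ^ k' b"
      using b by (simp add: k'_def power_eq_if)
    also have "(x \<bullet> b) * (x \<bullet> b) ^ k' b * (\<Prod>c\<in>Basis - {b}. (x \<bullet> c) ^ k' c)
        = (x \<bullet> b) * (\<Prod>c\<in>Basis. (x \<bullet> c) ^ k' c)"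
      using b prod.remove[of Basis b "\<lambda>c. (x \<bullet> c) ^ k' c"] by simp
    finally show ?thesis .
  qed
  ultimately show ?thesis
    using b by blast
qed

text \<open>This passes from exponent functions on \<open>Basis\<close>, which encode polynomials,
  to the coordinates in which the moments are computed.\<close>

lemma monomial_degree_le_2:
  fixes k :: "real ^ 'n::finite \<Rightarrow> nat"
  assumes "(\<Sum>b\<in>Basis. k b) \<le> 2"
  shows "(\<forall>x. (\<Prod>b\<in>Basis. (x \<bullet> b) ^ k b) = 1) \<or>
    (\<exists>i. \<forall>x. (\<Prod>b\<in>Basis. (x \<bullet> b) ^ k b) = x $ i) \<or>
    (\<exists>i j. \<forall>x. (\<Prod>b\<in>Basis. (x \<bullet> b) ^ k b) = x $ i * x $ j)"
proof -
  have const: "(\<Prod>b\<in>Basis. (x \<bullet> b) ^ k b) = 1" if "(\<Sum>b\<in>Basis. k b) = 0" for k and x :: "real ^ 'n"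
    using that by simp
  have coord: "\<exists>i. \<forall>x. x \<bullet> b = x $ i" if "b \<in> Basis" for b :: "real ^ 'n"
    using that by (auto simp: Basis_vec_def inner_axis)
  have linear: "\<exists>i. \<forall>x. (\<Prod>b\<in>Basis. (x \<bullet> b) ^ k b) = x $ i" if "(\<Sum>b\<in>Basis. k b) = 1" for k :: "real ^ 'n \<Rightarrow> nat"
    using monomial_split[of k 0] that const coord by (metis One_nat_def mult.right_neutral)
  have quadratic: "\<exists>i j. \<forall>x. (\<Prod>b\<in>Basis. (x \<bullet> b) ^ k b) = x $ i * x $ j" if "(\<Sum>b\<in>Basis. k b) = 2"
  proof -
    have "(\<Sum>b\<in>Basis. k b) = Suc 1" using that by simp
    from monomial_split[OF this] obtain b k' where b: "b \<in> Basis" "(\<Sum>b\<in>Basis. k' b) = 1"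
      "\<And>x. (\<Prod>b\<in>Basis. (x \<bullet> b) ^ k b) = (x \<bullet> b) * (\<Prod>b\<in>Basis. (x \<bullet> b) ^ k' b)"
      by blast
    obtain i where i: "\<And>x. x \<bullet> b = x $ i"
      using coord[OF b(1)] by blast
    obtain j where j: "\<And>x. (\<Prod>b\<in>Basis. (x \<bullet> b) ^ k' b) = x $ j"
      using linear[OF b(2)] by blast
    show ?thesis
      using b(3) i j by metis
  qed
  have "(\<Sum>b\<in>Basis. k b) = 0 \<or> (\<Sum>b\<in>Basis. k b) = 1 \<or> (\<Sum>b\<in>Basis. k b) = 2"
    using assms by linarith
  then show ?thesis
    using const linear quadratic by blast
qed

text \<open>By linearity it is enough to compare monomials, and the constant one agrees because both
  measures have mass one.\<close>

lemma integral_polynomial_degree_le_2_eq: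
  fixes M N :: "(real ^ 'n::finite) measure"
  assumes prob: "prob_space M" "prob_space N"
    and int: "\<And>h :: real ^ 'n \<Rightarrow> real. continuous_on UNIV h \<Longrightarrow> integrable M h"
      "\<And>h :: real ^ 'n \<Rightarrow> real. continuous_on UNIV h \<Longrightarrow> integrable N h"
    and first: "\<And>i. (\<integral>x. x $ i \<partial>M) = (\<integral>x. x $ i \<partial>N)"
    and second: "\<And>i j. (\<integral>x. x $ i * x $ j \<partial>M) = (\<integral>x. x $ i * x $ j \<partial>N)"
    and f: "polynomial_degree_le 2 f"
  shows "(\<integral>x. f x \<partial>M) = (\<integral>x. f x \<partial>N)"
proof -
  let ?K = "{k \<in> Basis \<rightarrow>\<^sub>E {..2}. (\<Sum>b\<in>Basis. k b) \<le> 2} :: (real ^ 'n \<Rightarrow> nat) set"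
  let ?m = "\<lambda>k (x :: real ^ 'n). \<Prod>b\<in>Basis. (x \<bullet> b) ^ k b"
  obtain c where c: "\<And>x. f x = (\<Sum>k\<in>?K. c k * ?m k x)"
    using f by (auto simp: polynomial_degree_le_def)
  have mono_int: "integrable M (?m k)" "integrable N (?m k)" for k
    by (auto intro!: int continuous_intros)
  have mono: "(\<integral>x. ?m k x \<partial>M) = (\<integral>x. ?m k x \<partial>N)" if "k \<in> ?K" for k
  proof -
    have "(\<Sum>b\<in>Basis. k b) \<le> 2" using that by simp
    from monomial_degree_le_2[OF this] show ?thesis
      using first second prob_space.prob_space[OF prob(1)] prob_space.prob_space[OF prob(2)] by auto
  qed
  have "(\<integral>x. f x \<partial>M) = (\<Sum>k\<in>?K. c k * (\<integral>x. ?m k x \<partial>M))"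
    unfolding c using mono_int by (subst Bochner_Integration.integral_sum) auto
  also have "\<dots> = (\<Sum>k\<in>?K. c k * (\<integral>x. ?m k x \<partial>N))"
    using mono by (intro sum.cong) auto
  also have "\<dots> = (\<integral>x. f x \<partial>N)"
    unfolding c using mono_int by (subst Bochner_Integration.integral_sum) auto
  finally show ?thesis .
qed

text \<open>The image of the span is a subspace of the span of the same dimension, so the inclusion
  for \<open>L\<close> becomes the equality that the invariance of the sphere measure asks
  for.\<close>

lemma permute_coords_span:
  fixes L :: "(real ^ 'n::finite) set"
  assumes "bij \<pi>" and "permute_coords \<pi> ` L \<subseteq> L"
  shows "permute_coords \<pi> ` span L = span L"
proof -
  have F: "orthogonal_transformation (permute_coords \<pi> :: real ^ 'n \<Rightarrow> real ^ 'n)"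
    using assms(1) by (rule orthogonal_transformation_permute_coords)
  note lin = orthogonal_transformation_linear[OF F]
  have "permute_coords \<pi> ` span L \<subseteq> span L"
    using assms(2) by (simp add: span_linear_image[OF lin, symmetric] span_mono)
  moreover have "dim (permute_coords \<pi> ` span L) = dim (span L)"
    using orthogonal_transformation_inj[OF F] by (intro dim_image_eq lin) (auto intro: inj_on_subset)
  ultimately show ?thesis
    using lin by (intro subspace_dim_equal) (auto intro: linear_subspace_image)
qed

section \<open>Lattices of integer vectors\<close>

text \<open>The norm bounds every coordinate, which leaves finitely many integers for each.\<close>

lemma finite_integer_vectors_cball:
  "finite {x :: real ^ 'n::finite. (\<forall>i. x $ i \<in> \<int>) \<and> norm x \<le> r}" (is "finite ?S")
proof -
  let ?T = "(\<lambda>y. \<chi> i. real_of_int (y i)) ` (UNIV \<rightarrow>\<^sub>E {-\<lceil>r\<rceil>..\<lceil>r\<rceil>})"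
  have "?S \<subseteq> ?T"
  proof
    fix x assume x: "x \<in> ?S"
    define y where "y i = \<lfloor>x $ i\<rfloor>" for i
    have y: "x $ i = real_of_int (y i)" for i
      using x by (auto simp: y_def elim: Ints_cases)
    have "y i \<in> {-\<lceil>r\<rceil>..\<lceil>r\<rceil>}" for i
    proof -
      have "\<bar>real_of_int (y i)\<bar> \<le> r"
        using component_le_norm_cart[of x i] x by (simp add: y)
      then show ?thesis
        by (auto simp: abs_le_iff) linarith+
    qed
    then have "y \<in> UNIV \<rightarrow>\<^sub>E {-\<lceil>r\<rceil>..\<lceil>r\<rceil>}" by auto
    moreover have "x = (\<chi> i. real_of_int (y i))"
      using y by (simp add: vec_eq_iff)
    ultimately show "x \<in> ?T" by blast
  qed
  then show ?thesis
    by (rule finite_subset) (intro finite_imageI finite_PiE, auto)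
qed

lemma discrete_integer_vectors:
  fixes L :: "(real ^ 'n::finite) set"
  assumes int: "\<And>x i. x \<in> L \<Longrightarrow> x $ i \<in> \<int>"
  shows "discrete L"
proof (rule discreteI)
  fix x assume x: "x \<in> L"
  have "y = x" if "y \<in> L" "dist x y < 1" for y
  proof -
    have "x $ i = y $ i" for i
    proof -
      have "\<bar>x $ i - y $ i\<bar> < 1"
        using component_le_norm_cart[of "x - y" i] that by (simp add: dist_norm)
      moreover have "x $ i - y $ i \<in> \<int>"
        using int x that by simp
      ultimately show ?thesis
        using Ints_nonzero_abs_less1[of "x $ i - y $ i"] by simp
    qed
    then show ?thesis by (simp add: vec_eq_iff)
  qed
  then show "x isolated_in L"
    unfolding isolated_in_dist_Ex_iff using x zero_less_one by blast
qed

text \<open>\<open>min_norm\<close> is an infimum, so attainment needs an argument: only finitely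
  many lattice vectors are at most as long as a chosen nonzero \<open>v\<close>, and the shortest
  nonzero one among them is shortest overall.\<close>

lemma min_vectors_integer_vectors:
  fixes L :: "(real ^ 'n::finite) set"
  assumes int: "\<And>x i. x \<in> L \<Longrightarrow> x $ i \<in> \<int>" and nonzero: "\<exists>x\<in>L. x \<noteq> 0"
  shows "min_norm L > 0" and "min_vectors L \<noteq> {}" and "finite (min_vectors L)"
proof -
  obtain v where v: "v \<in> L" "v \<noteq> 0"
    using nonzero by blast
  define S where "S = {x \<in> L. x \<noteq> 0 \<and> norm x \<le> norm v}"
  have "finite S"
    unfolding S_def using int by (intro finite_subset[OF _ finite_integer_vectors_cball[of "norm v"]]) auto
  moreover have "v \<in> S"
    using v by (simp add: S_def)
  ultimately obtain u where u: "u \<in> S" "\<And>x. x \<in> S \<Longrightarrow> norm u \<le> norm x"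
    by (metis arg_min_if_finite(1) arg_min_least empty_iff)
  have "min_norm L = norm u"
    unfolding min_norm_def
  proof (rule cInf_eq_minimum)
    show "norm u \<in> {norm x |x. x \<in> L \<and> x \<noteq> 0}"
      using u by (auto simp: S_def)
    show "norm u \<le> r" if r: "r \<in> {norm x |x. x \<in> L \<and> x \<noteq> 0}" for r
    proof -
      obtain x where x: "r = norm x" "x \<in> L" "x \<noteq> 0" using r by blast
      show ?thesis
      proof (cases "norm x \<le> norm v")
        case True
        then show ?thesis using u x by (simp add: S_def)
      next
        case False
        then show ?thesis using u(2)[OF \<open>v \<in> S\<close>] x by simp
      qed
    qed
  qed
  then show "min_norm L > 0" "min_vectors L \<noteq> {}"
    using u by (auto simp: S_def min_vectors_def)
  show "finite (min_vectors L)"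
    unfolding min_vectors_def using int
    by (intro finite_subset[OF _ finite_integer_vectors_cball[of "min_norm L"]]) auto
qed

text \<open>Coordinate permutations are isometries, so those preserving \<open>L\<close> also
  preserve its span and its minimal vectors. The sphere measure and the average over minimal vectors
  thus satisfy the same hypotheses on moments and get the same constants.\<close>

lemma strongly_eutactic_if_doubly_transitive:
  fixes L :: "(real ^ 'n::finite) set"
  assumes zero: "0 \<in> L" and diff: "\<And>x y. x \<in> L \<Longrightarrow> y \<in> L \<Longrightarrow> x - y \<in> L"
    and int: "\<And>x i. x \<in> L \<Longrightarrow> x $ i \<in> \<int>" and sum: "\<And>x. x \<in> L \<Longrightarrow> (\<Sum>i\<in>UNIV. x $ i) = 0"
    and nonzero: "\<exists>x\<in>L. x \<noteq> 0"
    and trans: "\<And>i j k l. i \<noteq> j \<Longrightarrow> k \<noteq> l \<Longrightarrow>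
      \<exists>\<pi>. bij \<pi> \<and> \<pi> i = k \<and> \<pi> j = l \<and> permute_coords \<pi> ` L \<subseteq> L"
  shows "strongly_eutactic L"
proof -
  define X where "X = (\<lambda>x. (1 / min_norm L) *\<^sub>R x) ` min_vectors L"
  note minimal = min_vectors_integer_vectors[OF int nonzero]
  have X: "finite X" "X \<noteq> {}"
    using minimal by (auto simp: X_def)
  have X_sphere: "X \<subseteq> sphere 0 1 \<inter> span L"
    using minimal(1) by (auto simp: X_def min_vectors_def intro!: span_scale[OF span_base])
  have V_sum: "(\<Sum>i\<in>UNIV. x $ i) = 0" if "x \<in> span L" for x
  proof -
    have "subspace {x :: real ^ 'n. (\<Sum>i\<in>UNIV. x $ i) = 0}"
      by (auto simp: subspace_def sum.distrib sum_distrib_left[symmetric])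
    then show ?thesis
      using span_minimal[of L "{x. (\<Sum>i\<in>UNIV. x $ i) = 0}"] sum that by auto
  qed
  have "span L \<noteq> {0}"
    using nonzero span_base by blast
  then obtain M where M: "uniform_sphere_measure (span L) M"
    using uniform_sphere_measure_exists[OF subspace_span] by blast
  \<comment> \<open>With a single coordinate, the vanishing coordinate sum would force
    \<open>L\<close> to be zero.\<close>
  have card: "CARD('n) \<ge> 2"
  proof (rule ccontr)
    assume "\<not> CARD('n) \<ge> 2"
    then have "card (UNIV :: 'n set) = 1"
      using zero_less_card_finite[where 'a = 'n] by linarith
    then obtain i :: 'n where "UNIV = {i}"
      by (rule card_1_singletonE)
    then have "x $ k = 0" if "x \<in> L" for x k
    proof -
      have "k = i" using \<open>UNIV = {i}\<close> by blast
      then show ?thesis using sum[OF that] unfolding \<open>UNIV = {i}\<close> by simp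
    qed
    then have "x = 0" if "x \<in> L" for x
      using that by (simp add: vec_eq_iff)
    then show False
      using nonzero by blast
  qed
  \<comment> \<open>The finite average is written as an integral so that the moment lemmas apply to
    it as they do to \<open>M\<close>.\<close>
  let ?N = "measure_pmf (pmf_of_set X)"
  have N_integral: "(\<integral>x. h x \<partial>?N) = (\<Sum>x\<in>X. h x) / real (card X)" for h :: "real ^ 'n \<Rightarrow> real"
    using X by (simp add: integral_pmf_of_set)
  have prob: "prob_space M" "prob_space ?N"
    using uniform_sphere_measure_prob_space[OF M] prob_space_measure_pmf by auto
  have integrable_M: "integrable M h" if "continuous_on UNIV h" for h :: "real ^ 'n \<Rightarrow> real"
    using M that by (rule uniform_sphere_measure_integrable)
  have integrable_N: "integrable ?N h" for h :: "real ^ 'n \<Rightarrow> real"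
    using X by (intro integrable_measure_pmf_finite) simp
  have AE_M: "AE x in M. norm x = 1" "AE x in M. (\<Sum>i\<in>UNIV. x $ i) = 0"
    using M V_sum by (auto simp: uniform_sphere_measure_def intro!: AE_I2)
  have AE_N: "AE x in ?N. norm x = 1" "AE x in ?N. (\<Sum>i\<in>UNIV. x $ i) = 0"
    using X X_sphere V_sum by (auto simp: AE_measure_pmf_iff)
  have trans_M: "\<exists>\<pi>. \<pi> i = k \<and> \<pi> j = l \<and> (\<forall>h :: real ^ 'n \<Rightarrow> real. continuous_on UNIV h \<longrightarrow>
      (\<integral>x. h (permute_coords \<pi> x) \<partial>M) = (\<integral>x. h x \<partial>M))" if "i \<noteq> j" "k \<noteq> l" for i j k l
  proof -
    obtain \<pi> where \<pi>: "bij \<pi>" "\<pi> i = k" "\<pi> j = l" "permute_coords \<pi> ` L \<subseteq> L"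
      using trans[OF \<open>i \<noteq> j\<close> \<open>k \<noteq> l\<close>] by blast
    then show ?thesis
      using uniform_sphere_measure_integral_invariant[OF M _ orthogonal_transformation_permute_coords
          permute_coords_span] by blast
  qed
  have trans_N: "\<exists>\<pi>. \<pi> i = k \<and> \<pi> j = l \<and> (\<forall>h :: real ^ 'n \<Rightarrow> real. continuous_on UNIV h \<longrightarrow>
      (\<integral>x. h (permute_coords \<pi> x) \<partial>?N) = (\<integral>x. h x \<partial>?N))" if "i \<noteq> j" "k \<noteq> l" for i j k l
  proof -
    obtain \<pi> where \<pi>: "bij \<pi>" "\<pi> i = k" "\<pi> j = l" "permute_coords \<pi> ` L \<subseteq> L"
      using trans[OF \<open>i \<noteq> j\<close> \<open>k \<noteq> l\<close>] by blast
    let ?F = "permute_coords \<pi> :: real ^ 'n \<Rightarrow> real ^ 'n"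
    note F = orthogonal_transformation_permute_coords[OF \<pi>(1)]
    have inj: "inj_on ?F S" for S
      using orthogonal_transformation_inj[OF F] by (rule inj_on_subset) simp
    have "?F ` min_vectors L \<subseteq> min_vectors L"
      using \<pi>(4) by (auto simp: min_vectors_def orthogonal_transformation_norm[OF F])
    then have "?F ` X \<subseteq> X"
      by (auto simp: X_def orthogonal_transformation_scaleR[OF F] image_subset_iff)
    \<comment> \<open>An injective map of a finite set into itself is onto, so sums over
      \<open>X\<close> can be reindexed.\<close>
    then have "?F ` X = X"
      using X(1) inj by (intro endo_inj_surj)
    then have "(\<Sum>x\<in>X. h (?F x)) = (\<Sum>x\<in>X. h x)" for h :: "real ^ 'n \<Rightarrow> real"
      using inj[of X] sum.reindex[of ?F X h] by simp
    then show ?thesis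
      using \<pi> by (auto simp: N_integral)
  qed
  have first: "(\<integral>x. x $ i \<partial>M) = 0" "(\<integral>x. x $ i \<partial>?N) = 0" for i
    by (intro doubly_transitive_first_moment prob integrable_M integrable_N AE_M AE_N trans_M trans_N card; assumption)+
  define m where "m i j = (if i = j then 1 / real CARD('n) else - 1 / (real CARD('n) * (real CARD('n) - 1)))"
    for i j :: 'n
  have second: "(\<integral>x. x $ i * x $ j \<partial>M) = m i j" "(\<integral>x. x $ i * x $ j \<partial>?N) = m i j" for i j
    unfolding m_def
    by (intro doubly_transitive_second_moment prob integrable_M integrable_N AE_M AE_N trans_M trans_N card; assumption)+
  have "(\<integral>x. f x \<partial>M) = (\<Sum>x\<in>X. f x) / real (card X)" if "polynomial_degree_le 2 f" for f
  proof -
    have "(\<integral>x. f x \<partial>M) = (\<integral>x. f x \<partial>?N)"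
      using prob integrable_M integrable_N _ _ that
      by (rule integral_polynomial_degree_le_2_eq) (simp_all only: first second)
    then show ?thesis
      by (simp only: N_integral)
  qed
  then have "spherical_design 2 (span L) X"
    unfolding spherical_design_def using X X_sphere M by blast
  moreover have "euclidean_lattice L"
    using zero diff discrete_integer_vectors[OF int] by (simp add: euclidean_lattice_def)
  ultimately show ?thesis
    by (simp add: strongly_eutactic_def X_def)
qed

section \<open>Affine maps of elementary Abelian groups\<close>

text \<open>
  The coordinates of an isomorphism with \<open>(\<int>/p\<int>)\<^sup>\<nu>\<close>, with values in \<open>int\<close> taken modulo \<open>p\<close>.
\<close>

locale mod_coordinates = comm_group G for G (structure) +
  fixes p :: nat and I :: "'i set" and c :: "'i \<Rightarrow> 'a \<Rightarrow> int"
  assumes prime_p: "prime p"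
    and coord_mult: "\<lbrakk>i \<in> I; x \<in> carrier G; y \<in> carrier G\<rbrakk> \<Longrightarrow> [c i (x \<otimes> y) = c i x + c i y] (mod int p)"
    and coord_separates: "\<lbrakk>x \<in> carrier G; \<And>i. i \<in> I \<Longrightarrow> [c i x = 0] (mod int p)\<rbrakk> \<Longrightarrow> x = \<one>"
    and exponent_p: "x \<in> carrier G \<Longrightarrow> x [^] p = \<one>"
begin

lemma prime_int_p: "prime (int p)"
  using prime_p by simp

text \<open>This allows a character value, meaningful only modulo \<open>p\<close>, to serve as an
  exponent.\<close>

lemma int_pow_cong:
  assumes "x \<in> carrier G" and "[m = n] (mod int p)"
  shows "x [^] m = x [^] n"
proof -
  obtain k where k: "m = n + int p * k"
    using assms(2) by (metis cong_iff_lin cong_sym)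
  have "x [^] (int p * k) = (x [^] int p) [^] k"
    using assms(1) by (simp add: int_pow_pow)
  then show ?thesis
    using assms(1) exponent_p by (simp add: k int_pow_mult int_pow_int)
qed

text \<open>A linear form over the field with \<open>p\<close> elements, represented by integers
  modulo \<open>p\<close>.\<close>

definition character :: "('a \<Rightarrow> int) \<Rightarrow> bool" where
  "character \<theta> \<longleftrightarrow> (\<forall>x\<in>carrier G. \<forall>y\<in>carrier G. [\<theta> (x \<otimes> y) = \<theta> x + \<theta> y] (mod int p))"

lemma character_mult:
  "\<lbrakk>character \<theta>; x \<in> carrier G; y \<in> carrier G\<rbrakk> \<Longrightarrow> [\<theta> (x \<otimes> y) = \<theta> x + \<theta> y] (mod int p)"
  by (simp add: character_def)

lemma character_one: "character \<theta> \<Longrightarrow> [\<theta> \<one> = 0] (mod int p)"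
  using character_mult[of \<theta> \<one> \<one>] by (simp add: cong_iff_dvd_diff)

lemma character_nat_pow:
  assumes "character \<theta>" "x \<in> carrier G"
  shows "[\<theta> (x [^] (n::nat)) = int n * \<theta> x] (mod int p)"
proof (induction n)
  case 0
  then show ?case using character_one[OF assms(1)] by simp
next
  case (Suc n)
  have "[\<theta> (x [^] Suc n) = \<theta> (x [^] n) + \<theta> x] (mod int p)"
    using character_mult[OF assms(1), of "x [^] n" x] assms(2) by simp
  also have "[\<theta> (x [^] n) + \<theta> x = int n * \<theta> x + \<theta> x] (mod int p)"
    using Suc by (intro cong_add) auto
  finally show ?case by (simp add: algebra_simps)
qed

lemma character_int_pow:
  assumes "character \<theta>" "x \<in> carrier G"
  shows "[\<theta> (x [^] (k::int)) = k * \<theta> x] (mod int p)"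
proof -
  \<comment> \<open>A nonnegative representative of \<open>k\<close> reduces the claim to natural
    powers.\<close>
  define n where "n = nat (k mod int p)"
  have "int n = k mod int p"
    using prime_gt_0_nat[OF prime_p] by (simp add: n_def)
  then have n: "[k = int n] (mod int p)"
    by (simp add: cong_def)
  have "x [^] k = x [^] n"
    using int_pow_cong[OF assms(2) n] by (simp add: int_pow_int)
  then have "[\<theta> (x [^] k) = int n * \<theta> x] (mod int p)"
    using character_nat_pow[OF assms] by simp
  also have "[int n * \<theta> x = k * \<theta> x] (mod int p)"
    using n by (intro cong_mult) (auto simp: cong_sym)
  finally show ?thesis .
qed

text \<open>A group is not the union of two proper subgroups, here the characters vanishing at
  \<open>a\<close> and those vanishing at \<open>b\<close>. Concretely, take one coordinate nonzero
  at \<open>a\<close> and one nonzero at \<open>b\<close>; if neither is nonzero at both, their sum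
  is.\<close>

lemma exists_character:
  assumes a: "a \<in> carrier G" "a \<noteq> \<one>" and b: "b \<in> carrier G" "b \<noteq> \<one>"
  shows "\<exists>\<theta>. character \<theta> \<and> [\<theta> a = 1] (mod int p) \<and> \<not> [\<theta> b = 0] (mod int p)"
proof -
  have char_c: "character (c i)" if "i \<in> I" for i
    using that by (simp add: character_def coord_mult)
  have char_scale: "character (\<lambda>x. k * \<theta> x)" if "character \<theta>" for k \<theta>
    unfolding character_def
  proof (intro ballI)
    fix x y assume "x \<in> carrier G" "y \<in> carrier G"
    then have "[k * \<theta> (x \<otimes> y) = k * (\<theta> x + \<theta> y)] (mod int p)"
      using that by (intro cong_mult) (auto simp: character_def)
    then show "[k * \<theta> (x \<otimes> y) = k * \<theta> x + k * \<theta> y] (mod int p)"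
      by (simp add: distrib_left)
  qed
  have char_add: "character (\<lambda>x. \<theta> x + \<psi> x)" if "character \<theta>" "character \<psi>" for \<theta> \<psi>
    unfolding character_def
  proof (intro ballI)
    fix x y assume "x \<in> carrier G" "y \<in> carrier G"
    then have "[\<theta> (x \<otimes> y) + \<psi> (x \<otimes> y) = (\<theta> x + \<theta> y) + (\<psi> x + \<psi> y)] (mod int p)"
      using that by (intro cong_add) (auto simp: character_def)
    then show "[\<theta> (x \<otimes> y) + \<psi> (x \<otimes> y) = \<theta> x + \<psi> x + (\<theta> y + \<psi> y)] (mod int p)"
      by (simp add: algebra_simps)
  qed
  have "\<exists>\<theta>. character \<theta> \<and> \<not> [\<theta> a = 0] (mod int p) \<and> \<not> [\<theta> b = 0] (mod int p)"
  proof -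
    obtain i where i: "i \<in> I" "\<not> [c i a = 0] (mod int p)"
      using coord_separates a by blast
    obtain j where j: "j \<in> I" "\<not> [c j b = 0] (mod int p)"
      using coord_separates b by blast
    show ?thesis
    proof (cases "[c i b = 0] (mod int p) \<and> [c j a = 0] (mod int p)")
      case True
      then have "\<not> [c i a + c j a = 0] (mod int p)" "\<not> [c i b + c j b = 0] (mod int p)"
        using i j by (auto simp: cong_0_iff dvd_add_left_iff dvd_add_right_iff)
      then show ?thesis
        using char_add[OF char_c char_c] i j by blast
    next
      case False
      then show ?thesis
        using char_c i j by blast
    qed
  qed
  then obtain \<theta> where \<theta>: "character \<theta>" "\<not> int p dvd \<theta> a" "\<not> int p dvd \<theta> b"
    by (auto simp: cong_0_iff)
  \<comment> \<open>Scaling by the inverse \<open>k\<close> of \<open>\<theta> a\<close> modulo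
    \<open>p\<close> normalises the value at \<open>a\<close>; as \<open>k\<close> is a unit, the
    value at \<open>b\<close> stays nonzero.\<close>
  have "coprime (\<theta> a) (int p)"
    using \<theta>(2) prime_int_p by (simp add: prime_imp_coprime coprime_commute)
  then obtain k where k: "[\<theta> a * k = 1] (mod int p)"
    using cong_solve_coprime_int by blast
  have "\<not> int p dvd k"
  proof
    assume "int p dvd k"
    then have "int p dvd 1"
      using k by (metis cong_dvd_iff dvd_mult)
    then show False
      using prime_int_p not_prime_unit by blast
  qed
  then have "\<not> [k * \<theta> b = 0] (mod int p)"
    using \<theta> prime_int_p by (simp add: cong_0_iff prime_dvd_mult_iff)
  then show ?thesis
    using k char_scale[OF \<theta>(1), of k] by (auto simp: mult.commute)
qed

text \<open>
  The transvection \<open>x \<mapsto> x \<otimes> d [^] \<theta> x\<close> with \<open>d = b \<otimes> inv a\<close> sends \<open>a\<close> to \<open>b\<close> when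
  \<open>\<theta> a = 1\<close>; it is injective since \<open>1 + \<theta> d = \<theta> b\<close> is invertible modulo \<open>p\<close>.
\<close>

lemma automorphism_transitive:
  assumes fin: "finite (carrier G)"
    and a: "a \<in> carrier G" "a \<noteq> \<one>" and b: "b \<in> carrier G" "b \<noteq> \<one>"
  shows "\<exists>\<phi>. \<phi> \<in> hom G G \<and> bij_betw \<phi> (carrier G) (carrier G) \<and> \<phi> a = b"
proof -
  obtain \<theta> where \<theta>: "character \<theta>" and \<theta>a: "[\<theta> a = 1] (mod int p)" and \<theta>b: "\<not> [\<theta> b = 0] (mod int p)"
    using exists_character[OF a b] by blast
  define d where "d = b \<otimes> inv a"
  have d: "d \<in> carrier G" "d \<otimes> a = b"
    using a b by (simp_all add: d_def m_assoc)
  define \<phi> where "\<phi> x = x \<otimes> d [^] \<theta> x" for x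
  have hom: "\<phi> \<in> hom G G"
  proof (rule homI)
    fix x y assume xy: "x \<in> carrier G" "y \<in> carrier G"
    have "d [^] \<theta> (x \<otimes> y) = d [^] \<theta> x \<otimes> d [^] \<theta> y"
      using int_pow_cong[OF d(1) character_mult[OF \<theta> xy]] d by (simp add: int_pow_mult)
    then show "\<phi> (x \<otimes> y) = \<phi> x \<otimes> \<phi> y"
      using xy d by (simp add: \<phi>_def m_ac)
  qed (use d in \<open>simp add: \<phi>_def\<close>)
  have "[\<theta> b = \<theta> d + \<theta> a] (mod int p)"
    using character_mult[OF \<theta>, of d a] d a by simp
  also have "[\<theta> d + \<theta> a = \<theta> d + 1] (mod int p)"
    using \<theta>a by (intro cong_add) auto
  finally have unit: "\<not> int p dvd \<theta> d + 1"
    using \<theta>b by (simp add: cong_0_iff cong_dvd_iff)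
  have kernel: "x = \<one>" if x: "x \<in> carrier G" "\<phi> x = \<one>" for x
  proof -
    \<comment> \<open>Applying \<open>\<theta>\<close> to \<open>\<phi> x = \<one>\<close> shows
      that \<open>p\<close> divides \<open>\<theta> x * (\<theta> d + 1)\<close>, hence
      \<open>\<theta> x\<close>; but then \<open>\<phi> x = x\<close>.\<close>
    have "[0 = \<theta> (x \<otimes> d [^] \<theta> x)] (mod int p)"
      using x character_one[OF \<theta>] by (simp add: \<phi>_def cong_sym)
    also have "[\<theta> (x \<otimes> d [^] \<theta> x) = \<theta> x + \<theta> (d [^] \<theta> x)] (mod int p)"
      using x d by (intro character_mult \<theta>) auto
    also have "[\<theta> x + \<theta> (d [^] \<theta> x) = \<theta> x + \<theta> x * \<theta> d] (mod int p)"
      using d by (intro cong_add character_int_pow \<theta>) auto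
    finally have "int p dvd \<theta> x * (\<theta> d + 1)"
      by (simp add: cong_0_iff cong_sym_eq[of 0] algebra_simps)
    then have "[\<theta> x = 0] (mod int p)"
      using unit prime_int_p by (simp add: cong_0_iff prime_dvd_mult_iff)
    then have "d [^] \<theta> x = \<one>"
      using int_pow_cong[OF d(1), of "\<theta> x" 0] by simp
    then show ?thesis
      using x by (simp add: \<phi>_def)
  qed
  interpret h: group_hom G G \<phi>
    using hom by (unfold_locales)
  have inj: "inj_on \<phi> (carrier G)"
    using kernel by (auto simp: h.inj_on_one_iff)
  have "\<phi> ` carrier G = carrier G"
    using inj fin by (intro endo_inj_surj) auto
  moreover have "\<phi> a = b"
    using int_pow_cong[OF d(1) \<theta>a] d a by (simp add: \<phi>_def m_comm)
  ultimately show ?thesis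
    using hom inj unfolding bij_betw_def by blast
qed

text \<open>Only the quotients \<open>x' \<otimes> inv x\<close> and
  \<open>y' \<otimes> inv y\<close> constrain the automorphism; the translation is then fixed by the
  image of \<open>x\<close>.\<close>

lemma affine_doubly_transitive:
  assumes fin: "finite (carrier G)"
    and x: "x \<in> carrier G" "x' \<in> carrier G" "x \<noteq> x'"
    and y: "y \<in> carrier G" "y' \<in> carrier G" "y \<noteq> y'"
  shows "\<exists>\<phi> t. \<phi> \<in> hom G G \<and> t \<in> carrier G \<and> bij_betw (\<lambda>z. \<phi> z \<otimes> t) (carrier G) (carrier G)
    \<and> \<phi> x \<otimes> t = y \<and> \<phi> x' \<otimes> t = y'"
proof -
  have "x' \<otimes> inv x \<noteq> \<one>" "y' \<otimes> inv y \<noteq> \<one>"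
    using x y by (metis inv_equality inv_inv inv_closed)+
  then obtain \<phi> where \<phi>: "\<phi> \<in> hom G G" "bij_betw \<phi> (carrier G) (carrier G)" "\<phi> (x' \<otimes> inv x) = y' \<otimes> inv y"
    using automorphism_transitive[OF fin, of "x' \<otimes> inv x" "y' \<otimes> inv y"] x y by auto
  define t where "t = inv (\<phi> x) \<otimes> y"
  have \<phi>_closed: "\<phi> z \<in> carrier G" if "z \<in> carrier G" for z
    using \<phi>(1) that by (auto simp: hom_def)
  have t: "t \<in> carrier G"
    using \<phi>_closed x y by (simp add: t_def)
  have "\<phi> x' = \<phi> (x' \<otimes> inv x \<otimes> x)"
    using x by (simp add: m_assoc)
  also have "\<dots> = y' \<otimes> inv y \<otimes> \<phi> x"
    using \<phi>(1,3) x by (simp add: hom_mult)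
  finally have x': "\<phi> x' = y' \<otimes> inv y \<otimes> \<phi> x" .
  have "\<phi> x \<otimes> t = y"
    using \<phi>_closed x y by (simp add: t_def m_assoc[symmetric])
  moreover have "\<phi> x' \<otimes> t = y'"
    using \<phi>_closed x y t \<open>\<phi> x \<otimes> t = y\<close> by (simp add: x' m_assoc)
  moreover have "bij_betw (\<lambda>z. \<phi> z \<otimes> t) (carrier G) (carrier G)"
  proof -
    have "bij_betw (\<lambda>z. z \<otimes> t) (carrier G) (carrier G)"
      using t by (intro bij_betwI[where g = "\<lambda>z. z \<otimes> inv t"]) (auto simp: m_assoc)
    from bij_betw_trans[OF \<phi>(2) this] show ?thesis by (simp add: comp_def)
  qed
  ultimately show ?thesis
    using \<phi>(1) t by blast
qed

end

lemma elementary_abelian_mod_coordinates: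
  fixes G (structure) and I :: "'i set"
  assumes G: "comm_group G" and p: "prime p"
    and iso: "G \<cong> product_group I (\<lambda>_. integer_mod_group p)"
  obtains c where "mod_coordinates G p I c"
proof -
  interpret comm_group G by fact
  let ?H = "product_group I (\<lambda>_. integer_mod_group p)"
  obtain \<psi> where "\<psi> \<in> iso G ?H"
    using iso by (auto simp: is_iso_def)
  then have hom: "\<psi> \<in> hom G ?H" and inj: "inj_on \<psi> (carrier G)"
    by (auto simp: iso_def bij_betw_def)
  have H: "group ?H" by simp
  have one: "\<psi> \<one> = \<one>\<^bsub>?H\<^esub>"
    using hom is_group H by (rule hom_one)
  have p0: "0 < p" using p by (simp add: prime_gt_0_nat)
  have \<psi>_closed: "\<psi> x \<in> carrier ?H" if "x \<in> carrier G" for x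
    using hom that by (rule hom_in_carrier)
  have "mod_coordinates G p I (\<lambda>i x. \<psi> x i)"
  proof unfold_locales
    show "prime p" by fact
    show "[\<psi> (x \<otimes> y) i = \<psi> x i + \<psi> y i] (mod int p)"
      if "i \<in> I" "x \<in> carrier G" "y \<in> carrier G" for i x y
      using that by (simp add: hom_mult[OF hom] cong_def)
    show "x = \<one>" if x: "x \<in> carrier G" and 0: "\<And>i. i \<in> I \<Longrightarrow> [\<psi> x i = 0] (mod int p)" for x
    proof -
      have "\<psi> x = \<one>\<^bsub>?H\<^esub>"
      proof
        fix i
        \<comment> \<open>Inside \<open>I\<close> the component is a reduced residue congruent to 0,
          hence 0; outside \<open>I\<close> both functions are \<open>undefined\<close> by
          extensionality.\<close>
        show "\<psi> x i = \<one>\<^bsub>?H\<^esub> i"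
          using \<psi>_closed[OF x] 0[of i] p0
          by (cases "i \<in> I") (auto simp: PiE_iff carrier_integer_mod_group cong_def extensional_def)
      qed
      then show ?thesis
        using one inj x by (metis inj_on_contraD one_closed)
    qed
    show "x [^] p = \<one>" if x: "x \<in> carrier G" for x
    proof -
      have pow: "(y [^]\<^bsub>?H\<^esub> (n::nat)) i = (int n * y i) mod int p" if "i \<in> I" for y n i
        using that by (induction n) (simp_all add: algebra_simps mod_simps)
      have "\<psi> (x [^] p) = \<psi> x [^]\<^bsub>?H\<^esub> p"
        using hom x is_group H by (rule hom_nat_pow)
      also have "\<dots> = \<one>\<^bsub>?H\<^esub>"
      proof
        fix i
        have "\<psi> x [^]\<^bsub>?H\<^esub> p \<in> carrier ?H"
          using H \<psi>_closed[OF x] by (simp add: group.is_monoid monoid.nat_pow_closed del: carrier_product_group)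
        then show "(\<psi> x [^]\<^bsub>?H\<^esub> p) i = \<one>\<^bsub>?H\<^esub> i"
          by (cases "i \<in> I") (auto simp: pow PiE_iff extensional_def)
      qed
      finally show ?thesis
        using one inj x by (metis inj_on_contraD one_closed nat_pow_closed)
    qed
  qed
  then show thesis
    by (rule that)
qed

section \<open>The lattice of a finite Abelian group\<close>

lemma (in group_hom) hom_finprod:
  assumes "comm_group G" "comm_group H" "finite A" "u \<in> A \<rightarrow> carrier G"
  shows "h (finprod G u A) = finprod H (\<lambda>i. h (u i)) A"
proof -
  interpret G: comm_group G by fact
  interpret H: comm_group H by fact
  show ?thesis
    using assms(3,4)
  proof (induction A rule: finite_induct)
    case (insert a A)
    then have "u a \<in> carrier G" "u \<in> A \<rightarrow> carrier G" by auto
    moreover from this have "(\<lambda>i. h (u i)) \<in> A \<rightarrow> carrier H" by (auto simp: Pi_iff)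
    ultimately show ?case
      using insert by simp
  qed simp
qed

lemma (in comm_group) finprod_int_pow:
  assumes "finite A" "t \<in> carrier G"
  shows "(\<Otimes>i\<in>A. t [^] (x i :: int)) = t [^] (\<Sum>i\<in>A. x i)"
  using assms by (induction A rule: finite_induct) (simp_all add: int_pow_mult)

context
  fixes G :: "('g, 'm) monoid_scheme" (structure) and g :: "'n::finite \<Rightarrow> 'g" and i\<^sub>0 :: 'n
  assumes G: "comm_group G" and g: "bij_betw g UNIV (carrier G)" and g_zero: "g i\<^sub>0 = \<one>"
begin

interpretation comm_group G by (fact G)

lemma enumeration_closed: "g i \<in> carrier G"
  using g by (auto simp: bij_betw_def)

text \<open>The factor at \<open>i\<^sub>0\<close> is a power of the identity. Including it makes
  the description symmetric in the indices, as is needed for permutations that move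
  \<open>i\<^sub>0\<close>.\<close>

lemma group_lattice_iff:
  "x \<in> group_lattice G g i\<^sub>0 \<longleftrightarrow> (\<exists>y :: 'n \<Rightarrow> int. x = (\<chi> i. of_int (y i)) \<and>
    (\<Sum>i\<in>UNIV. y i) = 0 \<and> (\<Otimes>i\<in>UNIV. g i [^] y i) = \<one>)"
proof -
  have "(\<Otimes>i\<in>UNIV. g i [^] y i) = (\<Otimes>i\<in>UNIV - {i\<^sub>0}. g i [^] y i)" for y :: "'n \<Rightarrow> int"
    by (rule finprod_mono_neutral_cong_right) (auto simp: g_zero enumeration_closed)
  then show ?thesis
    by (auto simp: group_lattice_def)
qed

lemma zero_in_group_lattice: "0 \<in> group_lattice G g i\<^sub>0"
  unfolding group_lattice_iff by (rule exI[of _ "\<lambda>_. 0"]) (simp add: vec_eq_iff)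

lemma group_lattice_diff:
  assumes "x \<in> group_lattice G g i\<^sub>0" "x' \<in> group_lattice G g i\<^sub>0"
  shows "x - x' \<in> group_lattice G g i\<^sub>0"
proof -
  obtain y y' where y: "x = (\<chi> i. of_int (y i))" "(\<Sum>i\<in>UNIV. y i) = 0" "(\<Otimes>i\<in>UNIV. g i [^] y i) = \<one>"
    and y': "x' = (\<chi> i. of_int (y' i))" "(\<Sum>i\<in>UNIV. y' i) = 0" "(\<Otimes>i\<in>UNIV. g i [^] y' i) = \<one>"
    using assms unfolding group_lattice_iff by blast
  \<comment> \<open>Multiplying by the product for \<open>y'\<close>, itself the identity, recovers
    the product for \<open>y\<close> and avoids inverting a finite product.\<close>
  have "(\<Otimes>i\<in>UNIV. g i [^] (y i - y' i)) \<otimes> (\<Otimes>i\<in>UNIV. g i [^] y' i)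
      = (\<Otimes>i\<in>UNIV. g i [^] (y i - y' i) \<otimes> g i [^] y' i)"
    by (rule finprod_multf[symmetric]) (auto simp: enumeration_closed)
  also have "\<dots> = (\<Otimes>i\<in>UNIV. g i [^] y i)"
    by (intro finprod_cong') (auto simp: enumeration_closed int_pow_mult[symmetric])
  finally have "(\<Otimes>i\<in>UNIV. g i [^] (y i - y' i)) = \<one>"
    by (simp add: y y' enumeration_closed)
  then show ?thesis
    unfolding group_lattice_iff using y y'
    by (intro exI[of _ "\<lambda>i. y i - y' i"]) (simp add: vec_eq_iff sum_subtractf)
qed

text \<open>With the inverse of \<open>\<sigma>\<close>, the new coordinate at
  \<open>\<sigma> i\<close> is the old one at \<open>i\<close>. Reindexing therefore turns the
  relation into the image under \<open>\<phi>\<close> of the old relation, times \<open>t\<close> to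
  the power of the coordinate sum.\<close>

lemma permute_coords_affine_group_lattice:
  assumes \<phi>: "\<phi> \<in> hom G G" and t: "t \<in> carrier G"
    and \<sigma>: "bij \<sigma>" "\<And>i. g (\<sigma> i) = \<phi> (g i) \<otimes> t"
  shows "permute_coords (inv_into UNIV \<sigma>) ` group_lattice G g i\<^sub>0 \<subseteq> group_lattice G g i\<^sub>0"
proof
  interpret h: group_hom G G \<phi>
    using \<phi> by unfold_locales
  fix z assume "z \<in> permute_coords (inv_into UNIV \<sigma>) ` group_lattice G g i\<^sub>0"
  then obtain x where "z = permute_coords (inv_into UNIV \<sigma>) x" "x \<in> group_lattice G g i\<^sub>0"
    by blast
  then obtain y where y: "z = permute_coords (inv_into UNIV \<sigma>) (\<chi> i. of_int (y i))"
      "(\<Sum>i\<in>UNIV. y i) = 0" "(\<Otimes>i\<in>UNIV. g i [^] y i) = \<one>"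
    unfolding group_lattice_iff by blast
  let ?w = "\<lambda>i. y (inv_into UNIV \<sigma> i)"
  have inv: "inv_into UNIV \<sigma> (\<sigma> i) = i" for i
    using \<sigma>(1) by (simp add: bij_is_inj)
  have "(\<Sum>i\<in>UNIV. ?w i) = 0"
    using sum.reindex_bij_betw[OF \<sigma>(1), of ?w] y(2) by (simp add: inv)
  moreover have "(\<Otimes>i\<in>UNIV. g i [^] ?w i) = \<one>"
  proof -
    have "(\<Otimes>i\<in>UNIV. g i [^] ?w i) = (\<Otimes>i\<in>\<sigma> ` UNIV. g i [^] ?w i)"
      using \<sigma>(1) by (simp add: bij_is_surj)
    also have "\<dots> = (\<Otimes>i\<in>UNIV. g (\<sigma> i) [^] ?w (\<sigma> i))"
      using \<sigma>(1) by (intro finprod_reindex) (auto simp: enumeration_closed bij_is_inj)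
    also have "\<dots> = (\<Otimes>i\<in>UNIV. \<phi> (g i [^] y i) \<otimes> t [^] y i)"
      using t by (intro finprod_cong')
        (auto simp: \<sigma>(2) inv enumeration_closed int_pow_distrib h.hom_int_pow)
    also have "\<dots> = (\<Otimes>i\<in>UNIV. \<phi> (g i [^] y i)) \<otimes> (\<Otimes>i\<in>UNIV. t [^] y i)"
      using t by (intro finprod_multf) (auto simp: enumeration_closed)
    also have "(\<Otimes>i\<in>UNIV. \<phi> (g i [^] y i)) = \<phi> (\<Otimes>i\<in>UNIV. g i [^] y i)"
      by (intro h.hom_finprod[symmetric] G) (auto simp: enumeration_closed)
    also have "(\<Otimes>i\<in>UNIV. t [^] y i) = \<one>"
      using t by (simp add: finprod_int_pow y(2))
    finally show ?thesis by (simp add: y(3))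
  qed
  ultimately show "z \<in> group_lattice G g i\<^sub>0"
    unfolding group_lattice_iff y(1) by (intro exI[of _ ?w]) (simp add: vec_eq_iff)
qed

text \<open>The witness is \<open>p\<close> times the difference of two unit vectors, since
  \<open>p\<close> annihilates the group.\<close>

lemma group_lattice_nonzero:
  fixes p :: nat and i j :: 'n
  assumes "i \<noteq> j" and p: "p > 0" "\<And>x. x \<in> carrier G \<Longrightarrow> x [^] p = \<one>"
  shows "\<exists>x\<in>group_lattice G g i\<^sub>0. x \<noteq> 0"
proof -
  define y where "y k = (if k = i then int p else if k = j then - int p else 0)" for k
  have "g k [^] y k = \<one>" for k
    using p(2)[OF enumeration_closed] enumeration_closed by (simp add: y_def int_pow_neg int_pow_int)
  then have "(\<Otimes>k\<in>UNIV. g k [^] y k) = \<one>"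
    by simp
  moreover have "(\<Sum>k\<in>UNIV. y k) = (\<Sum>k\<in>UNIV. (if k = i then int p else 0) - (if k = j then int p else 0))"
    using \<open>i \<noteq> j\<close> by (intro sum.cong) (auto simp: y_def)
  then have "(\<Sum>k\<in>UNIV. y k) = 0"
    by (simp add: sum_subtractf)
  ultimately have "(\<chi> k. of_int (y k)) \<in> group_lattice G g i\<^sub>0"
    unfolding group_lattice_iff by blast
  moreover have "(\<chi> k. real_of_int (y k)) $ i \<noteq> 0"
    using p by (simp add: y_def)
  ultimately show ?thesis
    by (metis zero_index)
qed

end

theorem theorem2p3:
  fixes G :: "('g, 'm) monoid_scheme"
    and g :: "'n::finite \<Rightarrow> 'g"
    and i\<^sub>0 :: 'n
    and p \<nu> :: nat
  assumes "comm_group G"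
    and "prime p"
    and "\<nu> \<ge> 1"
    and "G \<cong> product_group {..<\<nu>} (\<lambda>_. integer_mod_group p)"
    and "bij_betw g UNIV (carrier G)"
    and "g i\<^sub>0 = \<one>\<^bsub>G\<^esub>"
  shows "strongly_eutactic (group_lattice G g i\<^sub>0)"
proof -
  obtain c where "mod_coordinates G p {..<\<nu>} c"
    by (rule elementary_abelian_mod_coordinates[OF assms(1,2,4)])
  then interpret mod_coordinates G p "{..<\<nu>}" c .
  note lattice = assms(1,5,6)
  have fin: "finite (carrier G)"
    using bij_betw_finite[OF assms(5)] by simp
  have g_eq: "g i = g j \<longleftrightarrow> i = j" for i j
    using assms(5) by (auto simp: bij_betw_def inj_on_def)
  let ?H = "product_group {..<\<nu>} (\<lambda>_. integer_mod_group p)"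
  \<comment> \<open>A single index would make \<open>G\<close> trivial, whereas
    \<open>p ^ \<nu> > 1\<close>.\<close>
  have "\<exists>j. j \<noteq> i\<^sub>0"
  proof (rule ccontr)
    assume "\<nexists>j. j \<noteq> i\<^sub>0"
    then have "g j = \<one>\<^bsub>G\<^esub>" for j
      using assms(6) by metis
    then have "carrier G = {\<one>\<^bsub>G\<^esub>}"
      using bij_betw_imp_surj_on[OF assms(5)] by auto
    then have "card (carrier ?H) = 1"
      using iso_same_card[OF assms(4)] by simp
    moreover have "card (carrier ?H) = p ^ \<nu>"
      using prime_gt_0_nat[OF prime_p] by (simp add: card_PiE carrier_integer_mod_group)
    ultimately show False
      using one_less_power[OF prime_gt_1_nat[OF prime_p], of \<nu>] assms(3) by simp
  qed
  then obtain j where "j \<noteq> i\<^sub>0" ..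
  show ?thesis
  proof (rule strongly_eutactic_if_doubly_transitive)
    show "0 \<in> group_lattice G g i\<^sub>0"
      by (rule zero_in_group_lattice[OF lattice])
    show "x - y \<in> group_lattice G g i\<^sub>0" if "x \<in> group_lattice G g i\<^sub>0" "y \<in> group_lattice G g i\<^sub>0" for x y
      using that by (rule group_lattice_diff[OF lattice])
    show "x $ i \<in> \<int>" if "x \<in> group_lattice G g i\<^sub>0" for x i
      using that by (auto simp: group_lattice_def)
    show "(\<Sum>i\<in>UNIV. x $ i) = 0" if "x \<in> group_lattice G g i\<^sub>0" for x
      using that by (auto simp: group_lattice_def simp flip: of_int_sum)
    show "\<exists>x\<in>group_lattice G g i\<^sub>0. x \<noteq> 0"
      using \<open>j \<noteq> i\<^sub>0\<close> prime_gt_0_nat[OF prime_p] exponent_p by (rule group_lattice_nonzero[OF lattice])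
    show "\<exists>\<pi>. bij \<pi> \<and> \<pi> i = k \<and> \<pi> j = l \<and>
        permute_coords \<pi> ` group_lattice G g i\<^sub>0 \<subseteq> group_lattice G g i\<^sub>0" if "i \<noteq> j" "k \<noteq> l" for i j k l
    proof -
      have "g k \<noteq> g l" "g i \<noteq> g j"
        using that by (simp_all add: g_eq)
      \<comment> \<open>The map is asked to run backwards, from \<open>g k\<close> to
        \<open>g i\<close> and from \<open>g l\<close> to \<open>g j\<close>, because the coordinate
        permutation will be the inverse of \<open>\<sigma>\<close>.\<close>
      then obtain \<phi> t where \<phi>: "\<phi> \<in> hom G G" "t \<in> carrier G"
        and bij: "bij_betw (\<lambda>z. \<phi> z \<otimes>\<^bsub>G\<^esub> t) (carrier G) (carrier G)"
        and maps: "\<phi> (g k) \<otimes>\<^bsub>G\<^esub> t = g i" "\<phi> (g l) \<otimes>\<^bsub>G\<^esub> t = g j"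
        using affine_doubly_transitive[OF fin] enumeration_closed[OF lattice] by metis
      define \<sigma> where "\<sigma> = inv_into UNIV g \<circ> (\<lambda>z. \<phi> z \<otimes>\<^bsub>G\<^esub> t) \<circ> g"
      have "bij \<sigma>"
        unfolding \<sigma>_def using assms(5) bij by (intro bij_betw_trans bij_betw_inv_into)
      have \<sigma>: "g (\<sigma> i) = \<phi> (g i) \<otimes>\<^bsub>G\<^esub> t" for i
      proof -
        have "\<phi> (g i) \<otimes>\<^bsub>G\<^esub> t \<in> range g"
          using assms(5) bij by (auto simp: bij_betw_def)
        then show ?thesis
          by (simp add: \<sigma>_def f_inv_into_f)
      qed
      have "\<sigma> k = i" "\<sigma> l = j"
        using \<sigma> maps g_eq by metis+
      then have "inv_into UNIV \<sigma> i = k" "inv_into UNIV \<sigma> j = l"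
        using \<open>bij \<sigma>\<close> by (auto simp: bij_is_inj)
      moreover have "bij (inv_into UNIV \<sigma>)"
        using \<open>bij \<sigma>\<close> by (rule bij_imp_bij_inv)
      ultimately show ?thesis
        using permute_coords_affine_group_lattice[OF lattice \<phi> \<open>bij \<sigma>\<close> \<sigma>] by blast
    qed
  qed
qed

end
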